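(* Let $d\geq 2$, let $K\subset\mathbb{R}^d$ be a convex compact set, and let $1<p<\infty$. Then there exists $u:\mathbb{R}^d\to\mathbb{R}^d$ with $u\in \dot{W}^{1,dp}(\mathbb{R}^d)\cap L^\infty(\mathbb{R}^d)$ such that $$\det(\nabla u)=\mathbf{1}_{K}\quad\text{a.e. in }\mathbb{R}^d.$$
   Context: $\mathbf{1}_K$ is the characteristic (indicator) function of $K$. For a map $u:\mathbb{R}^d\to\mathbb{R}^d$, $\nabla u$ is the $d\times d$ Jacobian matrix of weak partial derivatives. The homogeneous Sobolev space $\dot{W}^{1,dp}(\mathbb{R}^d)$ consists here of the locally integrable, weakly differentiable maps $u:\mathbb{R}^d\to\mathbb{R}^d$ with $\nabla u\in L^{dp}(\mathbb{R}^d)$. *)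

theory Defs
  imports "HOL-Analysis.Analysis"
begin

definition partial_deriv :: "'n::finite \<Rightarrow> (real^'n \<Rightarrow> real) \<Rightarrow> real^'n \<Rightarrow> real" where
  "partial_deriv i f x = frechet_derivative f (at x) (axis i 1)"

(* C^k on the whole space: a function is C^(k+1) iff it is differentiable and all of its
   first order partial derivatives are C^k. *)
primrec Ck :: "nat \<Rightarrow> (real^'n::finite \<Rightarrow> real) \<Rightarrow> bool" where
  "Ck 0 f \<longleftrightarrow> continuous_on UNIV f"
| "Ck (Suc k) f \<longleftrightarrow> f differentiable_on UNIV \<and> (\<forall>i. Ck k (partial_deriv i f))"

definition test_function :: "(real^'n::finite \<Rightarrow> real) \<Rightarrow> bool" where
  "test_function \<phi> \<longleftrightarrow> (\<forall>k. Ck k \<phi>) \<and> compact (closure {x. \<phi> x \<noteq> 0})"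

definition locally_integrable :: "('a::euclidean_space \<Rightarrow> 'b::euclidean_space) \<Rightarrow> bool" where
  "locally_integrable f \<longleftrightarrow> (\<forall>C. compact C \<longrightarrow> f absolutely_integrable_on C)"

definition has_weak_partial :: "'n::finite \<Rightarrow> (real^'n \<Rightarrow> real) \<Rightarrow> (real^'n \<Rightarrow> real) \<Rightarrow> bool" where
  "has_weak_partial i f g \<longleftrightarrow>
     locally_integrable f \<and> locally_integrable g \<and>
     (\<forall>\<phi>. test_function \<phi> \<longrightarrow>
        (LINT x|lebesgue. f x * partial_deriv i \<phi> x) = - (LINT x|lebesgue. g x * \<phi> x))"

(* Weak derivatives are determined only almost everywhere, so the weak Jacobian is a relation:
   G is a representative of the weak Jacobian of u, with entry (i, j) the j-th weak partial
   derivative of the i-th component. *)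
definition has_weak_jacobian ::
    "(real^'n::finite \<Rightarrow> real^'n) \<Rightarrow> (real^'n \<Rightarrow> real^'n^'n) \<Rightarrow> bool" where
  "has_weak_jacobian u G \<longleftrightarrow> (\<forall>i j. has_weak_partial j (\<lambda>x. u x $ i) (\<lambda>x. G x $ i $ j))"

(* L^q on the whole space, as functions rather than classes modulo null sets. On matrices,
   norm is the Frobenius norm. *)
definition Lq :: "real \<Rightarrow> ('a::euclidean_space \<Rightarrow> 'b::euclidean_space) set" where
  "Lq q = {f. f \<in> borel_measurable lebesgue \<and> integrable lebesgue (\<lambda>x. norm (f x) powr q)}"

definition Linf :: "('a::euclidean_space \<Rightarrow> 'b::euclidean_space) set" where
  "Linf = {f. f \<in> borel_measurable lebesgue \<and> (\<exists>C. AE x in lebesgue. norm (f x) \<le> C)}"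

definition homogeneous_sobolev :: "real \<Rightarrow> (real^'n::finite \<Rightarrow> real^'n) set" where
  "homogeneous_sobolev q =
     {u. locally_integrable u \<and> (\<exists>G. has_weak_jacobian u G \<and> G \<in> Lq q)}"

end

(* Proof idea. If K has empty interior it is negligible and u = 0 works. Otherwise let a be an interior
   point, h the maximum of 1 and the Minkowski gauge of K centred at a, and u x = (x - a) / h x. On K the
   gradient of u is the identity; outside K, u is constant along the rays from a, so its gradient is
   singular, and it decays like 1 / |x|, which makes it an element of L^q for q > d.

   Since h is convex and Lipschitz, its one-sided directional derivatives exist everywhere, and they are
   weak derivatives by translation invariance of Lebesgue measure and dominated convergence. Left and right
   derivatives agree almost everywhere, and then they are the components of every subgradient s; outside K,
   Euler's identity s . (x - a) = h x holds for the maximiser s of the support function of the polar body. *)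
theory Submission
  imports Defs
begin

subsection \<open>Integrability of decaying weights\<close>

text \<open>On the half-line there is an explicit antiderivative that vanishes at infinity because 1
  - p < 0; the reflection t -> -t handles the other half.\<close>

lemma nn_integral_inverse_powr_finite:
  fixes p :: real
  assumes "1 < p"
  shows "(\<integral>\<^sup>+t. ennreal ((1 + \<bar>t\<bar>) powr (- p)) \<partial>lborel) < \<infinity>"
proof -
  let ?f = "\<lambda>t::real. (1 + \<bar>t\<bar>) powr (- p)"
  let ?g = "\<lambda>t::real. ennreal (?f t) * indicator {0..} t"
  let ?F = "\<lambda>t::real. (1 + t) powr (1 - p) / (1 - p)"
  have "(\<integral>\<^sup>+t. ennreal ((1 + t) powr (- p)) * indicator {0..} t \<partial>lborel) = ennreal (0 - ?F 0)"
  proof (rule nn_integral_FTC_atLeast)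
    show "(?F has_real_derivative (1 + x) powr (- p)) (at x)" if "0 \<le> x" for x
    proof -
      have "((\<lambda>t. (1 + t) powr (1 - p)) has_real_derivative (1 - p) * (1 + x) powr (- p)) (at x)"
        using that by (auto intro!: derivative_eq_intros)
      from DERIV_cdivide[OF this, of "1 - p"] show ?thesis
        using assms by simp
    qed
    have "filterlim (\<lambda>t::real. 1 + t) at_top at_top"
      by (rule filterlim_tendsto_add_at_top[OF tendsto_const filterlim_ident])
    from tendsto_neg_powr[OF _ this, of "1 - p"]
    have "((\<lambda>t. (1 + t) powr (1 - p)) \<longlongrightarrow> 0) at_top"
      using assms by simp
    from tendsto_divide[OF this tendsto_const, of "1 - p"]
    show "(?F \<longlongrightarrow> 0) at_top"
      using assms by simp
  qed auto
  moreover have "(\<integral>\<^sup>+t. ?g t \<partial>lborel) = (\<integral>\<^sup>+t. ennreal ((1 + t) powr (- p)) * indicator {0..} t \<partial>lborel)"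
    by (intro nn_integral_cong) (auto simp: indicator_def)
  ultimately have g: "(\<integral>\<^sup>+t. ?g t \<partial>lborel) < \<infinity>"
    by simp
  have g': "(\<integral>\<^sup>+t. ?g (- t) \<partial>lborel) = (\<integral>\<^sup>+t. ?g t \<partial>lborel)"
    using nn_integral_real_affine[of ?g "-1" 0] by simp
  \<comment> \<open>Both half-line pieces count the point 0, hence an inequality and not an
    equality.\<close>
  have "(\<integral>\<^sup>+t. ennreal (?f t) \<partial>lborel) \<le> (\<integral>\<^sup>+t. ?g t + ?g (- t) \<partial>lborel)"
    by (intro nn_integral_mono) (auto simp: indicator_def)
  also have "\<dots> = (\<integral>\<^sup>+t. ?g t \<partial>lborel) + (\<integral>\<^sup>+t. ?g (- t) \<partial>lborel)"
    by (intro nn_integral_add) auto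
  also have "\<dots> < \<infinity>"
    using g g' by simp
  finally show ?thesis .
qed

text \<open>Each coordinate is at most the norm in absolute value, so the exponent
  \<open>DIM('a) * p\<close> can be shared out as one factor with exponent \<open>p\<close> per
  coordinate. The product integral then reduces to dimension one.\<close>

lemma integrable_inverse_powr:
  fixes p :: real
  assumes "1 < p"
  shows "integrable lborel (\<lambda>x::'a::euclidean_space. (1 + norm x) powr (- (DIM('a) * p)))"
proof (rule integrableI_nonneg)
  have "ennreal ((1 + norm x) powr (- (DIM('a) * p)))
      \<le> (\<Prod>b\<in>Basis. ennreal ((1 + \<bar>x \<bullet> b\<bar>) powr (- p)))" for x :: 'a
  proof -
    have "(1 + norm x) powr (- (DIM('a) * p)) = ((1 + norm x) powr (- p)) powr DIM('a)"
      by (simp add: powr_powr mult.commute)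
    also have "\<dots> = (\<Prod>b\<in>(Basis::'a set). (1 + norm x) powr (- p))"
      using norm_ge_zero[of x] by (subst powr_realpow) (auto simp del: norm_ge_zero)
    also have "\<dots> \<le> (\<Prod>b\<in>Basis. (1 + \<bar>x \<bullet> b\<bar>) powr (- p))"
      using assms by (intro prod_mono) (auto intro!: powr_mono2' simp: Basis_le_norm)
    finally show ?thesis
      by (simp add: prod_ennreal ennreal_leI)
  qed
  then have "(\<integral>\<^sup>+(x::'a). ennreal ((1 + norm x) powr (- (DIM('a) * p))) \<partial>lborel)
      \<le> (\<integral>\<^sup>+(x::'a). (\<Prod>b\<in>Basis. ennreal ((1 + \<bar>x \<bullet> b\<bar>) powr (- p))) \<partial>lborel)"
    by (intro nn_integral_mono)
  also have "\<dots> = (\<Prod>b\<in>(Basis::'a set). \<integral>\<^sup>+t. ennreal ((1 + \<bar>t\<bar>) powr (- p)) \<partial>lborel)"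
    by (rule nn_integral_lborel_prod) auto
  also have "\<dots> < \<infinity>"
    using nn_integral_inverse_powr_finite[OF assms] by (simp add: power_less_top_ennreal)
  finally show "(\<integral>\<^sup>+(x::'a). ennreal ((1 + norm x) powr (- (DIM('a) * p))) \<partial>lborel) < \<infinity>" .
qed auto

subsection \<open>Weak derivatives as limits of difference quotients\<close>

text \<open>The steps run through 1 / (n + 1), so that measurability and dominated convergence for
  sequences apply. In direction \<open>- v\<close> this is minus the left difference quotient along
  \<open>v\<close>.\<close>

definition dir_quot :: "('a::real_vector \<Rightarrow> real) \<Rightarrow> 'a \<Rightarrow> nat \<Rightarrow> 'a \<Rightarrow> real" where
  "dir_quot f v n x = real (Suc n) * (f (x + v /\<^sub>R real (Suc n)) - f x)"

lemma measurable_dir_quot [measurable]: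
  fixes f :: "'a::euclidean_space \<Rightarrow> real"
  assumes [measurable]: "f \<in> borel_measurable borel"
  shows "dir_quot f v n \<in> borel_measurable borel"
  unfolding dir_quot_def by measurable

lemma abs_dir_quot_le:
  fixes f :: "'a::real_normed_vector \<Rightarrow> real"
  assumes "L-lipschitz_on UNIV f"
  shows "\<bar>dir_quot f v n x\<bar> \<le> L * norm v"
proof -
  have "\<bar>f (x + v /\<^sub>R real (Suc n)) - f x\<bar> \<le> L * norm v / real (Suc n)"
    using lipschitz_onD[OF assms, of "x + v /\<^sub>R real (Suc n)" x]
    by (simp add: dist_norm divide_inverse mult_ac)
  then have "real (Suc n) * \<bar>f (x + v /\<^sub>R real (Suc n)) - f x\<bar> \<le> L * norm v"
    by (subst (asm) pos_le_divide_eq) (simp_all only: of_nat_0_less_iff zero_less_Suc mult.commute)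
  then show ?thesis
    by (simp only: dir_quot_def abs_mult abs_of_nat)
qed

lemma integrable_translate:
  fixes f :: "'a::euclidean_space \<Rightarrow> real"
  assumes "integrable lborel f"
  shows "integrable lborel (\<lambda>x. f (x + c))"
    and "(\<integral>x. f (x + c) \<partial>lborel) = (\<integral>x. f x \<partial>lborel)"
proof -
  have [measurable]: "f \<in> borel_measurable borel"
    using borel_measurable_integrable[OF assms] by simp
  have d: "distr lborel borel (\<lambda>x. x + c) = (lborel :: 'a measure)"
    using lborel_distr_plus[of c] by (subst add.commute)
  show "integrable lborel (\<lambda>x. f (x + c))"
    using assms by (subst (asm) d[symmetric], subst (asm) integrable_distr_eq) auto
  show "(\<integral>x. f (x + c) \<partial>lborel) = (\<integral>x. f x \<partial>lborel)"
    by (subst (2) d[symmetric], subst integral_distr) auto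
qed

text \<open>Discrete integration by parts: translation invariance moves the shift from
  \<open>\<phi>\<close> to \<open>f\<close> and reverses its direction. Boundedness of
  \<open>f\<close> makes each product integrable on its own, so the integral of the difference
  splits.\<close>

lemma integral_dir_quot_by_parts:
  fixes f \<phi> :: "'a::euclidean_space \<Rightarrow> real"
  assumes [measurable]: "f \<in> borel_measurable borel"
    and B: "\<And>x. \<bar>f x\<bar> \<le> B" and \<phi>: "integrable lborel \<phi>"
  shows "(\<integral>x. f x * dir_quot \<phi> v n x \<partial>lborel) = (\<integral>x. dir_quot f (- v) n x * \<phi> x \<partial>lborel)"
proof -
  let ?v = "v /\<^sub>R real (Suc n)"
  have [measurable]: "\<phi> \<in> borel_measurable borel"
    using borel_measurable_integrable[OF \<phi>] by simp
  have int: "integrable lborel (\<lambda>x. f (x + c) * \<phi> (x + d))" for c d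
    by (rule Bochner_Integration.integrable_bound[OF integrable_mult_right[OF integrable_translate(1)[OF \<phi>, of d], of B]])
      (auto simp: abs_mult intro!: mult_mono order_trans[OF B abs_ge_self])
  have i1: "integrable lborel (\<lambda>x. f x * \<phi> (x + ?v))" 
    and i2: "integrable lborel (\<lambda>x. f x * \<phi> x)" 
    and i3: "integrable lborel (\<lambda>x. f (x - ?v) * \<phi> x)" 
    using int[of 0 ?v] int[of 0 0] int[of "- ?v" 0] by simp_all
  have "(\<integral>x. f x * dir_quot \<phi> v n x \<partial>lborel)
      = (\<integral>x. real (Suc n) * (f x * \<phi> (x + ?v) - f x * \<phi> x) \<partial>lborel)"
    by (simp add: dir_quot_def algebra_simps)
  also have "\<dots> = real (Suc n) * ((\<integral>x. f x * \<phi> (x + ?v) \<partial>lborel) - (\<integral>x. f x * \<phi> x \<partial>lborel))"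
    using i1 i2 by simp
  also have "(\<integral>x. f x * \<phi> (x + ?v) \<partial>lborel) = (\<integral>x. f (x - ?v) * \<phi> x \<partial>lborel)"
    using integrable_translate(2)[OF i3, of ?v] by simp
  also have "real (Suc n) * ((\<integral>x. f (x - ?v) * \<phi> x \<partial>lborel) - (\<integral>x. f x * \<phi> x \<partial>lborel))
     = (\<integral>x. real (Suc n) * (f (x - ?v) * \<phi> x - f x * \<phi> x) \<partial>lborel)"
    using i2 i3 by simp
  also have "\<dots> = (\<integral>x. dir_quot f (- v) n x * \<phi> x \<partial>lborel)"
    by (simp add: dir_quot_def algebra_simps)
  finally show ?thesis .
qed

section \<open>Difference quotients of test functions\<close>

lemma continuous_test_function:
  assumes "test_function \<phi>"
  shows "continuous_on UNIV \<phi>"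
  using assms unfolding test_function_def by (metis Ck.simps(1))

text \<open>The chain rule along a coordinate line turns partial derivatives into derivatives in one
  real variable, where the mean value theorem is available.\<close>

lemma test_function_DERIV:
  assumes "test_function \<phi>"
  shows "((\<lambda>t. \<phi> (x + t *\<^sub>R axis i 1)) has_real_derivative partial_deriv i \<phi> (x + t *\<^sub>R axis i 1)) (at t)"
proof -
  have "Ck (Suc 0) \<phi>"
    using assms unfolding test_function_def by blast
  then have "(\<phi> has_derivative frechet_derivative \<phi> (at y)) (at y)" for y
    by (simp add: differentiable_on_def frechet_derivative_works)
  then have d: "(\<phi> has_derivative frechet_derivative \<phi> (at (x + t *\<^sub>R axis i 1))) (at (x + t *\<^sub>R axis i 1))" .
  have "((\<lambda>t. \<phi> (x + t *\<^sub>R axis i 1)) has_derivative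
      (\<lambda>h. frechet_derivative \<phi> (at (x + t *\<^sub>R axis i 1)) (h *\<^sub>R axis i 1))) (at t)"
    by (rule has_derivative_compose[where g = \<phi> and f = "\<lambda>t. x + t *\<^sub>R axis i 1", OF _ d]) (auto intro!: derivative_eq_intros)
  then show ?thesis
    by (simp add: has_field_derivative_def partial_deriv_def linear_cmul[OF has_derivative_linear[OF d]] mult_commute_abs)
qed

lemma dir_quot_tendsto_partial_deriv:
  assumes "test_function \<phi>"
  shows "(\<lambda>n. dir_quot \<phi> (axis i 1) n x) \<longlonglongrightarrow> partial_deriv i \<phi> x"
proof -
  have "((\<lambda>t. (\<phi> (x + t *\<^sub>R axis i 1) - \<phi> x) / t) \<longlongrightarrow> partial_deriv i \<phi> x) (at 0)"
    using test_function_DERIV[OF assms, of x i 0] by (simp add: DERIV_def)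
  moreover have "filterlim (\<lambda>n. inverse (real (Suc n))) (at 0) sequentially"
    using LIMSEQ_inverse_real_of_nat by (auto simp: filterlim_at)
  ultimately have "(\<lambda>n. (\<phi> (x + inverse (real (Suc n)) *\<^sub>R axis i 1) - \<phi> x) / inverse (real (Suc n)))
      \<longlonglongrightarrow> partial_deriv i \<phi> x"
    by (rule filterlim_compose)
  then show ?thesis
    by (simp add: dir_quot_def field_simps)
qed

text \<open>This supplies a dominating function. Steps have length at most 1, so the quotients
  vanish one unit beyond a ball around the support; inside, the mean value theorem makes them values
  of the continuous partial derivative.\<close>

lemma dir_quot_test_function_bound:
  fixes \<phi> :: "real^'n::finite \<Rightarrow> real"
  assumes "test_function \<phi>"
  obtains B r where "\<And>n x. \<bar>dir_quot \<phi> (axis i 1) n x\<bar> \<le> B * indicator (cball 0 r) x"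
proof -
  let ?S = "closure {x. \<phi> x \<noteq> 0}"
  have S: "compact ?S"
    using assms by (simp add: test_function_def)
  have cont: "continuous_on UNIV (partial_deriv i \<phi>)"
    using assms unfolding test_function_def by (metis Ck.simps)
  obtain r where r: "\<And>x. x \<in> ?S \<Longrightarrow> norm x \<le> r"
    using compact_imp_bounded[OF S] by (auto simp: bounded_iff)
  \<comment> \<open>The mean value point is within distance 1 of a point of norm at most r + 1,
    hence the radius r + 2.\<close>
  have "bounded (partial_deriv i \<phi> ` cball 0 (r + 2))"
    by (intro compact_imp_bounded compact_continuous_image continuous_on_subset[OF cont]) auto
  then obtain B where B: "\<And>x. norm x \<le> r + 2 \<Longrightarrow> \<bar>partial_deriv i \<phi> x\<bar> \<le> B"
    unfolding bounded_iff by (metis image_eqI mem_cball_0 real_norm_def)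
  have zero: "\<phi> x = 0" if "norm x > r" for x
    using r[of x] that closure_subset[of "{x. \<phi> x \<noteq> 0}"] by force
  have "\<bar>dir_quot \<phi> (axis i 1) n x\<bar> \<le> B * indicator (cball 0 (r + 1)) x" for n x
  proof (cases "norm x \<le> r + 1")
    case True
    let ?t = "inverse (real (Suc n))"
    have t: "0 < ?t" "?t \<le> 1"
      by (auto simp: inverse_le_1_iff)
    obtain z where z: "0 < z" "z < ?t"
      "\<phi> (x + ?t *\<^sub>R axis i 1) - \<phi> (x + 0 *\<^sub>R axis i 1) = (?t - 0) * partial_deriv i \<phi> (x + z *\<^sub>R axis i 1)"
      using MVT2[OF t(1), of "\<lambda>t. \<phi> (x + t *\<^sub>R axis i 1)" "\<lambda>t. partial_deriv i \<phi> (x + t *\<^sub>R axis i 1)"]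
        test_function_DERIV[OF assms] by blast
    then have "dir_quot \<phi> (axis i 1) n x = partial_deriv i \<phi> (x + z *\<^sub>R axis i 1)"
      by (simp add: dir_quot_def)
    moreover have "norm (x + z *\<^sub>R axis i 1) \<le> r + 2"
      using norm_triangle_ineq[of x "z *\<^sub>R axis i 1"] True z t by simp
    ultimately show ?thesis
      using True B by simp
  next
    case False
    have "norm (axis i 1 /\<^sub>R real (Suc n) :: real^'n) \<le> 1"
      by (simp add: inverse_le_1_iff)
    then have "norm (x + axis i 1 /\<^sub>R real (Suc n)) > r"
      using norm_triangle_ineq2[of x "- (axis i 1 /\<^sub>R real (Suc n))"] False by simp
    then show ?thesis
      using False zero by (simp add: dir_quot_def)
  qed
  then show ?thesis
    by (rule that)
qed

lemma integrable_test_function: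
  fixes \<phi> :: "real^'n::finite \<Rightarrow> real"
  assumes "test_function \<phi>"
  shows "integrable lborel \<phi>"
proof -
  let ?S = "closure {x. \<phi> x \<noteq> 0}"
  have "integrable lborel (\<lambda>x. indicator ?S x *\<^sub>R \<phi> x)"
    using assms by (intro borel_integrable_compact continuous_on_subset[OF continuous_test_function])
      (auto simp: test_function_def)
  moreover have "(\<lambda>x. indicator ?S x *\<^sub>R \<phi> x) = \<phi>"
    using closure_subset[of "{x. \<phi> x \<noteq> 0}"] by (force simp: indicator_def)
  ultimately show ?thesis
    by simp
qed

section \<open>Weak derivatives of bounded Lipschitz functions\<close>

lemma locally_integrable_bounded:
  fixes f :: "'a::euclidean_space \<Rightarrow> 'b::euclidean_space"
  assumes "f \<in> borel_measurable borel" "\<And>x. norm (f x) \<le> B"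
  shows "locally_integrable f"
  unfolding locally_integrable_def
proof (intro allI impI)
  fix C :: "'a set" assume C: "compact C"
  show "f absolutely_integrable_on C"
  proof (rule measurable_bounded_by_integrable_imp_absolutely_integrable)
    show "f \<in> borel_measurable (lebesgue_on C)"
      using assms(1) by (intro measurable_restrict_space1 measurable_completion) simp
    show "C \<in> sets lebesgue"
      using C by (simp add: lmeasurable_compact fmeasurableD)
    show "(\<lambda>x. B) integrable_on C"
      using C by (intro integrable_on_const lmeasurable_compact)
  qed (use assms in auto)
qed

text \<open>Both sides of the discrete integration by parts converge by dominated convergence: one
  by the bound for test functions, the other by \<open>L\<close> times the modulus of
  \<open>\<phi>\<close>. The shift reverses direction, so the limit asked for is along
  \<open>- axis j 1\<close>, and \<open>g\<close> is the left derivative.\<close>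

lemma has_weak_partial_lipschitz:
  fixes f :: "real^'n::finite \<Rightarrow> real"
  assumes B: "\<And>x. \<bar>f x\<bar> \<le> B" and L: "L-lipschitz_on UNIV f"
    and lim: "\<And>x. (\<lambda>n. dir_quot f (- axis j 1) n x) \<longlonglongrightarrow> - g x"
  shows "has_weak_partial j f g"
  unfolding has_weak_partial_def
proof (intro conjI allI impI)
  have f [measurable]: "f \<in> borel_measurable borel"
    using lipschitz_on_continuous_on[OF L] by (simp add: borel_measurable_continuous_onI)
  have "(\<lambda>x. - g x) \<in> borel_measurable borel"
    by (rule borel_measurable_LIMSEQ_real[OF lim]) simp
  then have g [measurable]: "g \<in> borel_measurable borel"
    by simp
  have Q: "\<bar>dir_quot f (- axis j 1) n x\<bar> \<le> L" for n x
    using abs_dir_quot_le[OF L, of "- axis j 1" n x] by simp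
  have gL: "\<bar>g x\<bar> \<le> L" for x
    using LIMSEQ_le_const2[OF tendsto_rabs[OF lim[of x]], of L] Q by auto
  show "locally_integrable f"
    by (rule locally_integrable_bounded[of _ B]) (auto simp: B)
  show "locally_integrable g"
    by (rule locally_integrable_bounded[of _ L]) (auto simp: gL)
  fix \<phi> :: "real^'n \<Rightarrow> real" assume \<phi>: "test_function \<phi>"
  note i\<phi> = integrable_test_function[OF \<phi>]
  have [measurable]: "\<phi> \<in> borel_measurable borel"
    using borel_measurable_integrable[OF i\<phi>] by simp
  have [measurable]: "partial_deriv j \<phi> \<in> borel_measurable borel"
    by (rule borel_measurable_LIMSEQ_real[OF dir_quot_tendsto_partial_deriv[OF \<phi>]]) simp
  obtain D r where D: "\<And>n x. \<bar>dir_quot \<phi> (axis j 1) n x\<bar> \<le> D * indicator (cball 0 r) x"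
    using dir_quot_test_function_bound[OF \<phi>] by blast
  have "(\<lambda>n. \<integral>x. f x * dir_quot \<phi> (axis j 1) n x \<partial>lborel) \<longlonglongrightarrow> (\<integral>x. f x * partial_deriv j \<phi> x \<partial>lborel)"
  proof (rule integral_dominated_convergence)
    show "integrable lborel (\<lambda>x::real^'n. B * (D * indicator (cball 0 r) x))"
      by (intro integrable_mult_right integrable_real_indicator) (auto simp: emeasure_lborel_cball_finite[unfolded infinity_ennreal_def])
    show "AE x in lborel. norm (f x * dir_quot \<phi> (axis j 1) n x) \<le> B * (D * indicator (cball 0 r) x)" for n
      using B D by (auto simp: abs_mult intro!: mult_mono order_trans[OF abs_ge_zero B])
  qed (auto intro!: tendsto_intros dir_quot_tendsto_partial_deriv[OF \<phi>])
  moreover have "(\<lambda>n. \<integral>x. dir_quot f (- axis j 1) n x * \<phi> x \<partial>lborel) \<longlonglongrightarrow> (\<integral>x. - (g x * \<phi> x) \<partial>lborel)"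
  proof (rule integral_dominated_convergence)
    show "integrable lborel (\<lambda>x::real^'n. L * \<bar>\<phi> x\<bar>)"
      using i\<phi> by auto
    show "AE x in lborel. norm (dir_quot f (- axis j 1) n x * \<phi> x) \<le> L * \<bar>\<phi> x\<bar>" for n
      using Q by (auto simp: abs_mult intro!: mult_right_mono)
    show "AE x in lborel. (\<lambda>n. dir_quot f (- axis j 1) n x * \<phi> x) \<longlonglongrightarrow> - (g x * \<phi> x)"
      using tendsto_mult_right[OF lim] by simp
  qed auto
  ultimately have "(\<integral>x. f x * partial_deriv j \<phi> x \<partial>lborel) = (\<integral>x. - (g x * \<phi> x) \<partial>lborel)"
    unfolding integral_dir_quot_by_parts[OF f B i\<phi>] by (rule LIMSEQ_unique)
  \<comment> \<open>The integrands are Borel measurable, so completing the measure leaves their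
    integrals unchanged.\<close>
  then show "(LINT x|lebesgue. f x * partial_deriv j \<phi> x) = - (LINT x|lebesgue. g x * \<phi> x)"
    by (simp add: integral_completion)
qed

subsection \<open>One-sided derivatives of convex functions\<close>

text \<open>The one-sided directional derivative. As \<open>lim\<close> is total, its value carries
  meaning only where the quotients converge; \<open>tendsto_dir_lim\<close> ensures this for convex
  Lipschitz functions.\<close>

definition dir_lim :: "('a::real_vector \<Rightarrow> real) \<Rightarrow> 'a \<Rightarrow> 'a \<Rightarrow> real" where
  "dir_lim f v x = lim (\<lambda>n. dir_quot f v n x)"

text \<open>The point at step 1 / (m + 1) lies on the segment from \<open>x\<close> to the point at
  step 1 / m; convexity there, multiplied by m + 1, compares the two secant slopes.\<close>

lemma convex_decseq_dir_quot:
  assumes "convex_on UNIV f"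
  shows "decseq (\<lambda>n. dir_quot f v n x)"
proof (rule decseq_SucI)
  fix n
  define m where "m = real (Suc n)"
  have m: "m > 0" "real (Suc (Suc n)) = m + 1"
    by (auto simp: m_def)
  let ?t = "m / (m + 1)"
  have "?t *\<^sub>R (v /\<^sub>R m) = v /\<^sub>R (m + 1)"
    using m by (simp add: divide_inverse mult.assoc[symmetric] right_inverse mult.commute[of _ "inverse m"])
  moreover have "(1 - ?t) *\<^sub>R x + ?t *\<^sub>R (x + v /\<^sub>R m) = x + ?t *\<^sub>R (v /\<^sub>R m)"
    by (simp only: scaleR_add_right scaleR_left_diff_distrib scaleR_one diff_add_eq_diff_diff_swap add_diff_eq diff_add_cancel add.assoc[symmetric])
  ultimately have "f (x + v /\<^sub>R (m + 1)) = f ((1 - ?t) *\<^sub>R x + ?t *\<^sub>R (x + v /\<^sub>R m))"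
    by (simp only:)
  also have "\<dots> \<le> (1 - ?t) * f x + ?t * f (x + v /\<^sub>R m)"
    using m by (intro convex_onD[OF assms]) auto
  finally have "(m + 1) * f (x + v /\<^sub>R (m + 1)) \<le> (m + 1) * ((1 - ?t) * f x + ?t * f (x + v /\<^sub>R m))"
    using m by (intro mult_left_mono) auto
  also have "\<dots> = ((m + 1) * (1 - ?t)) * f x + ((m + 1) * ?t) * f (x + v /\<^sub>R m)"
    by (simp only: distrib_left mult.assoc)
  also have "\<dots> = f x + m * f (x + v /\<^sub>R m)"
    using m by (simp add: right_diff_distrib)
  finally show "dir_quot f v (Suc n) x \<le> dir_quot f v n x"
    unfolding dir_quot_def m(2) m_def[symmetric] by (simp add: algebra_simps)
qed

text \<open>The point \<open>x\<close> is the midpoint of its two shifts.\<close>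

lemma convex_dir_quot_add_nonneg:
  assumes "convex_on UNIV f"
  shows "0 \<le> dir_quot f v n x + dir_quot f (- v) n x"
proof -
  let ?v = "v /\<^sub>R real (Suc n)"
  have "x = (1 - 1 / 2) *\<^sub>R (x + ?v) + (1 / 2) *\<^sub>R (x - ?v)"
    by (simp add: algebra_simps flip: scaleR_add_left)
  then have "f x \<le> (1 - 1 / 2) * f (x + ?v) + (1 / 2) * f (x - ?v)"
    using convex_onD[OF assms, of "1 / 2" "x + ?v" "x - ?v"] by simp
  then have "0 \<le> real (Suc n) * (f (x + ?v) + f (x - ?v) - 2 * f x)"
    by (intro mult_nonneg_nonneg) auto
  then show ?thesis
    by (simp add: dir_quot_def algebra_simps)
qed

text \<open>The quotients decrease by convexity and are bounded below by the Lipschitz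
  estimate.\<close>

lemma tendsto_dir_lim:
  fixes f :: "'a::real_normed_vector \<Rightarrow> real"
  assumes "convex_on UNIV f" and L: "L-lipschitz_on UNIV f"
  shows "(\<lambda>n. dir_quot f v n x) \<longlonglongrightarrow> dir_lim f v x"
proof -
  have "- (L * norm v) \<le> dir_quot f v n x" for n
    using abs_dir_quot_le[OF L, of v n x] by linarith
  then obtain l where "(\<lambda>n. dir_quot f v n x) \<longlonglongrightarrow> l"
    using decseq_convergent[OF convex_decseq_dir_quot[OF assms(1)]] by metis
  then show ?thesis
    unfolding dir_lim_def by (simp add: limI)
qed

lemma abs_dir_lim_le:
  fixes f :: "'a::real_normed_vector \<Rightarrow> real"
  assumes "convex_on UNIV f" "L-lipschitz_on UNIV f"
  shows "\<bar>dir_lim f v x\<bar> \<le> L * norm v"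
  using LIMSEQ_le_const2[OF tendsto_rabs[OF tendsto_dir_lim[OF assms]]] abs_dir_quot_le[OF assms(2)]
  by blast

lemma measurable_dir_lim:
  fixes f :: "'a::euclidean_space \<Rightarrow> real"
  assumes "convex_on UNIV f" "L-lipschitz_on UNIV f"
  shows "dir_lim f v \<in> borel_measurable borel"
proof (rule borel_measurable_LIMSEQ_real[OF tendsto_dir_lim[OF assms]])
  show "dir_quot f v n \<in> borel_measurable borel" for n
    using lipschitz_on_continuous_on[OF assms(2)]
    by (intro measurable_dir_quot borel_measurable_continuous_onI)
qed

text \<open>The subgradient inequality at the shifted point, multiplied by n + 1, bounds every
  quotient. Used for \<open>v\<close> and \<open>- v\<close>, this determines s \<bullet> v once the
  two one-sided derivatives agree.\<close>

lemma subgradient_le_dir_lim: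
  fixes f :: "'a::euclidean_space \<Rightarrow> real"
  assumes "convex_on UNIV f" "L-lipschitz_on UNIV f"
    and s: "\<And>y. f x + s \<bullet> (y - x) \<le> f y"
  shows "s \<bullet> v \<le> dir_lim f v x"
proof (rule LIMSEQ_le_const[OF tendsto_dir_lim[OF assms(1,2)]])
  have "s \<bullet> v \<le> dir_quot f v n x" for n
  proof -
    have "real (Suc n) * (s \<bullet> (v /\<^sub>R real (Suc n))) \<le> dir_quot f v n x"
      unfolding dir_quot_def using s[of "x + v /\<^sub>R real (Suc n)"] by (intro mult_left_mono) auto
    then show ?thesis
      by (simp add: mult.assoc[symmetric] del: of_nat_Suc)
  qed
  then show "\<exists>N. \<forall>n\<ge>N. s \<bullet> v \<le> dir_quot f v n x"
    by blast
qed

text \<open>Tested against an integrable weight \<open>w\<close> that varies slowly, the sum of the two one-sided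
  derivatives becomes, by translation invariance, the limit of difference quotients tested against
  \<open>w x - w (x + v / (n + 1))\<close>, which is zero. Convexity makes the sum nonnegative.\<close>

lemma AE_convex_dir_lim_minus:
  fixes f :: "'a::euclidean_space \<Rightarrow> real"
  assumes cvx: "convex_on UNIV f" and L: "L-lipschitz_on UNIV f"
  shows "AE x in lborel. dir_lim f (- v) x = - dir_lim f v x"
proof -
  let ?v = "\<lambda>n. v /\<^sub>R real (Suc n)"
  \<comment> \<open>This is the integrable weight for p = 2. Its decay is polynomial, so bounded
    translations change it by at most a constant factor.\<close>
  let ?q = "real DIM('a) * 2"
  define w :: "'a \<Rightarrow> real" where "w x = (1 + norm x) powr (- ?q)" for x
  have w: "integrable lborel w"
    unfolding w_def by (rule integrable_inverse_powr) simp
  have [measurable]: "w \<in> borel_measurable borel"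
    unfolding w_def by measurable
  have [measurable]: "f \<in> borel_measurable borel"
    using lipschitz_on_continuous_on[OF L] by (rule borel_measurable_continuous_onI)
  have [measurable]: "dir_lim f u \<in> borel_measurable borel" for u
    by (rule measurable_dir_lim[OF cvx L])
  have w_pos: "0 < w x" for x
    using norm_ge_zero[of x] by (auto simp: w_def simp del: norm_ge_zero)
  \<comment> \<open>The factor comes from 1 + |x| \<le> (1 + |v|) (1 + |x + v / (n + 1)|) and does
    not depend on \<open>n\<close>, as domination requires.\<close>
  have w_shift: "w (x + ?v n) \<le> (1 + norm v) powr ?q * w x" for n x
  proof -
    have "norm (?v n) \<le> norm v"
      using mult_right_mono[of "inverse (real (Suc n))" 1 "norm v"] by (simp add: inverse_le_1_iff)
    then have "1 + norm x \<le> 1 + norm (x + ?v n) + norm v"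
      using norm_triangle_ineq4[of "x + ?v n" "?v n"] by simp
    also have "\<dots> \<le> (1 + norm v) * (1 + norm (x + ?v n))"
      by (simp add: algebra_simps)
    finally have "(1 + norm x) powr ?q \<le> ((1 + norm v) * (1 + norm (x + ?v n))) powr ?q"
      by (intro powr_mono2) auto
    also have "\<dots> = (1 + norm v) powr ?q * (1 + norm (x + ?v n)) powr ?q"
      by (simp add: powr_mult)
    finally show ?thesis
      using w_pos[of x] w_pos[of "x + ?v n"] unfolding w_def powr_minus
      by (simp add: field_simps)
  qed
  define Q where "Q n x = dir_quot f v n x" for n x
  have Q_le: "\<bar>Q n x\<bar> \<le> L * norm v" for n x
    unfolding Q_def by (rule abs_dir_quot_le[OF L])
  \<comment> \<open>The backward quotient is minus the forward one at the shifted point. After a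
    translation the sum of both therefore becomes a difference of weights.\<close>
  have Q_minus: "dir_quot f (- v) n x = - Q n (x - ?v n)" for n x
    by (simp add: Q_def dir_quot_def algebra_simps)
  have [measurable]: "Q n \<in> borel_measurable borel" for n
    unfolding Q_def by measurable
  have LN: "0 \<le> L * norm v"
    using order_trans[OF abs_ge_zero Q_le] by blast
  let ?D = "\<lambda>x. dir_lim f v x + dir_lim f (- v) x"
  have lim1: "(\<lambda>n. \<integral>x. (Q n x + dir_quot f (- v) n x) * w x \<partial>lborel) \<longlonglongrightarrow> (\<integral>x. ?D x * w x \<partial>lborel)"
    and int_D: "integrable lborel (\<lambda>x. ?D x * w x)"
  proof -
    have bound: "AE x in lborel. norm ((Q n x + dir_quot f (- v) n x) * w x) \<le> 2 * (L * norm v) * w x" for n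
    proof (rule AE_I2)
      fix x
      have "\<bar>Q n x + dir_quot f (- v) n x\<bar> \<le> 2 * (L * norm v)"
        using Q_le[of n x] Q_le[of n "x - ?v n"] unfolding Q_minus by linarith
      then show "norm ((Q n x + dir_quot f (- v) n x) * w x) \<le> 2 * (L * norm v) * w x"
        using w_pos[of x] by (simp add: abs_mult mult_right_mono)
    qed
    have lim: "AE x in lborel. (\<lambda>n. (Q n x + dir_quot f (- v) n x) * w x) \<longlonglongrightarrow> ?D x * w x"
      unfolding Q_def by (intro AE_I2 tendsto_intros tendsto_dir_lim[OF cvx L])
    have iw: "integrable lborel (\<lambda>x. 2 * (L * norm v) * w x)"
      using w by simp
    show "(\<lambda>n. \<integral>x. (Q n x + dir_quot f (- v) n x) * w x \<partial>lborel) \<longlonglongrightarrow> (\<integral>x. ?D x * w x \<partial>lborel)"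
      by (rule integral_dominated_convergence[OF _ _ iw lim bound]) auto
    show "integrable lborel (\<lambda>x. ?D x * w x)"
      by (rule integrable_dominated_convergence[OF _ _ iw lim bound]) auto
  qed
  have shift: "(\<integral>x. (Q n x + dir_quot f (- v) n x) * w x \<partial>lborel) = (\<integral>x. Q n x * (w x - w (x + ?v n)) \<partial>lborel)" for n
  proof -
    have int: "integrable lborel (\<lambda>x. Q n x * w (x + c))" for c
    proof (rule Bochner_Integration.integrable_bound)
      show "integrable lborel (\<lambda>x. L * norm v * w (x + c))"
        by (intro integrable_mult_right integrable_translate(1) w)
      show "AE x in lborel. norm (Q n x * w (x + c)) \<le> norm (L * norm v * w (x + c))"
        unfolding real_norm_def abs_mult[of "Q n _"] abs_mult[of "L * norm v"] abs_of_nonneg[OF LN]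
        by (intro AE_I2 mult_right_mono Q_le) auto
    qed auto
    have i1: "integrable lborel (\<lambda>x. Q n x * w x)"
      using int[of 0] by simp
    have i2: "integrable lborel (\<lambda>x. Q n (x - ?v n) * w x)"
      using integrable_translate(1)[OF int[of "?v n"], of "- ?v n"] by simp
    have "(\<integral>x. Q n (x - ?v n) * w x \<partial>lborel) = (\<integral>x. Q n x * w (x + ?v n) \<partial>lborel)"
      using integrable_translate(2)[OF i2, of "?v n"] by simp
    then show ?thesis
      using i1 i2 int[of "?v n"] by (simp add: Q_minus algebra_simps)
  qed
  have "(\<lambda>n. \<integral>x. Q n x * (w x - w (x + ?v n)) \<partial>lborel) \<longlonglongrightarrow> (\<integral>x. 0 \<partial>(lborel :: 'a measure))"
  proof (rule integral_dominated_convergence)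
    show "integrable lborel (\<lambda>x. L * norm v * ((1 + (1 + norm v) powr ?q) * w x))"
      using w by simp
    show "AE x in lborel. norm (Q n x * (w x - w (x + ?v n))) \<le> L * norm v * ((1 + (1 + norm v) powr ?q) * w x)" for n
    proof (rule AE_I2)
      fix x
      have "\<bar>w x - w (x + ?v n)\<bar> \<le> (1 + (1 + norm v) powr ?q) * w x"
        using w_pos[of x] w_pos[of "x + ?v n"] w_shift[of x n] by (simp add: distrib_right)
      then show "norm (Q n x * (w x - w (x + ?v n))) \<le> L * norm v * ((1 + (1 + norm v) powr ?q) * w x)"
        unfolding real_norm_def abs_mult by (intro mult_mono Q_le LN) auto
    qed
    show "AE x in lborel. (\<lambda>n. Q n x * (w x - w (x + ?v n))) \<longlonglongrightarrow> 0"
    proof (rule AE_I2)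
      fix x
      have "(\<lambda>n. x + inverse (real (Suc n)) *\<^sub>R v) \<longlonglongrightarrow> x + 0 *\<^sub>R v"
        by (intro tendsto_intros LIMSEQ_inverse_real_of_nat)
      then have "(\<lambda>n. w (x + ?v n)) \<longlonglongrightarrow> w x"
        unfolding w_def by (intro tendsto_intros) (auto simp: add_nonneg_eq_0_iff)
      then have "(\<lambda>n. Q n x * (w x - w (x + ?v n))) \<longlonglongrightarrow> dir_lim f v x * (w x - w x)"
        unfolding Q_def by (intro tendsto_intros tendsto_dir_lim[OF cvx L])
      then show "(\<lambda>n. Q n x * (w x - w (x + ?v n))) \<longlonglongrightarrow> 0"
        by simp
    qed
  qed auto
  \<comment> \<open>Both expressions are limits of the same integrals. As the integrand is
    nonnegative and \<open>w\<close> positive, the sum of the one-sided derivatives vanishes almost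
    everywhere.\<close>
  with lim1 have "(\<integral>x. ?D x * w x \<partial>lborel) = 0"
    unfolding shift by (simp add: LIMSEQ_unique)
  moreover have "AE x in lborel. 0 \<le> ?D x * w x"
  proof (rule AE_I2)
    fix x
    have "0 \<le> ?D x"
      by (rule LIMSEQ_le_const[OF tendsto_add[OF tendsto_dir_lim[OF cvx L] tendsto_dir_lim[OF cvx L]]])
        (use convex_dir_quot_add_nonneg[OF cvx] in blast)
    then show "0 \<le> ?D x * w x"
      using w_pos[of x] by simp
  qed
  ultimately have "AE x in lborel. ?D x * w x = 0"
    using integral_nonneg_eq_0_iff_AE[OF int_D] by simp
  then show ?thesis
    by eventually_elim (use w_pos in \<open>auto simp: less_le\<close>)
qed

subsection \<open>The gauge of a convex body\<close>

text \<open>A function with an affine minorant touching it at every point is convex; Cauchy-Schwarz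
  turns the uniform bound on the slopes into a Lipschitz constant.\<close>

lemma convex_lipschitz_of_subgradients:
  fixes f :: "'a::real_inner \<Rightarrow> real"
  assumes sub: "\<And>x. \<exists>s. norm s \<le> M \<and> (\<forall>y. f x + s \<bullet> (y - x) \<le> f y)"
  shows "convex_on UNIV f" and "M-lipschitz_on UNIV f"
proof -
  show "convex_on UNIV f"
  proof (rule convex_onI)
    fix t :: real and x y :: 'a assume t: "0 < t" "t < 1"
    define z where "z = (1 - t) *\<^sub>R x + t *\<^sub>R y"
    obtain s where s: "\<And>y. f z + s \<bullet> (y - z) \<le> f y"
      using sub by blast
    \<comment> \<open>The slope terms cancel because \<open>z\<close> is the weighted mean of
      \<open>x\<close> and \<open>y\<close>.\<close>
    have "f z = (1 - t) * (f z + s \<bullet> (x - z)) + t * (f z + s \<bullet> (y - z))"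
      by (simp add: z_def algebra_simps inner_simps)
    also have "\<dots> \<le> (1 - t) * f x + t * f y"
      using t by (intro add_mono mult_left_mono s) auto
    finally show "f ((1 - t) *\<^sub>R x + t *\<^sub>R y) \<le> (1 - t) * f x + t * f y"
      by (simp add: z_def)
  qed auto
  have le: "f x - f y \<le> M * norm (x - y)" for x y
  proof -
    obtain s where s: "norm s \<le> M" "f x + s \<bullet> (y - x) \<le> f y"
      using sub by blast
    have "f x - f y \<le> s \<bullet> (x - y)"
      using s(2) by (simp add: inner_diff_right)
    also have "\<dots> \<le> norm s * norm (x - y)"
      by (rule norm_cauchy_schwarz)
    also have "\<dots> \<le> M * norm (x - y)"
      using s(1) by (rule mult_right_mono) simp
    finally show ?thesis .
  qed
  show "M-lipschitz_on UNIV f"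
  proof (rule lipschitz_onI)
    show "dist (f x) (f y) \<le> M * dist x y" for x y
      using le[of x y] le[of y x] by (simp add: dist_norm norm_minus_commute)
    show "0 \<le> M"
      using sub norm_ge_zero order_trans by blast
  qed
qed

text \<open>The function \<open>h\<close> is the maximum of 1 and the Minkowski gauge of \<open>K\<close> centred at \<open>a\<close>; the
  gauge is the support function of the polar body \<open>C\<close>, whose maximisers are the subgradients.\<close>

lemma convex_body_gauge:
  fixes K :: "'a::euclidean_space set"
  assumes "convex K" "compact K" and a: "a \<in> interior K"
  obtains h M R where "\<And>x. 1 \<le> h x" "\<And>x. norm (x - a) \<le> R * h x" "0 < R"
    and "\<And>x. \<exists>s. norm s \<le> M \<and> (\<forall>y. h x + s \<bullet> (y - x) \<le> h y) \<and>
           (if x \<in> K then h x = 1 \<and> s = 0 else s \<bullet> (x - a) = h x)"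
proof -
  define C where "C = {s. \<forall>y\<in>K. s \<bullet> (y - a) \<le> 1}"
  obtain r where r: "0 < r" "cball a r \<subseteq> K"
    using a by (auto simp: mem_interior_cball)
  have aK: "a \<in> K"
    using a interior_subset by blast
  have C_bound: "norm s \<le> 1 / r" if "s \<in> C" for s
  proof (cases "s = 0")
    case False
    \<comment> \<open>The point of the inscribed ball farthest in direction \<open>s\<close>, where
      the polar inequality reads r |s| \<le> 1.\<close>
    let ?y = "a + (r / norm s) *\<^sub>R s"
    have "?y \<in> K"
      using r False by (intro subsetD[OF r(2)]) (simp add: dist_norm)
    then have "s \<bullet> (?y - a) \<le> 1"
      using that by (auto simp: C_def)
    moreover have "s \<bullet> (?y - a) = r * norm s"
      using False by (simp add: dot_square_norm power2_eq_square)
    ultimately show ?thesis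
      using r by (simp add: field_simps)
  qed (use r in simp)
  have "C = (\<Inter>y\<in>K. {s. s \<bullet> (y - a) \<le> 1})"
    by (auto simp: C_def)
  moreover have "closed {s. s \<bullet> (y - a) \<le> 1}" for y
    using closed_halfspace_le[of "y - a" 1] by (simp add: inner_commute)
  ultimately have "closed C"
    by auto
  moreover have "bounded C"
    using C_bound by (auto simp: bounded_iff)
  ultimately have C: "compact C"
    by (simp add: compact_eq_bounded_closed)
  have "0 \<in> C"
    by (simp add: C_def)
  have "\<exists>t\<in>C. \<forall>s\<in>C. s \<bullet> (x - a) \<le> t \<bullet> (x - a)" for x
    using \<open>0 \<in> C\<close> by (intro continuous_attains_sup[OF C]) (auto intro!: continuous_intros)
  then obtain \<sigma> where \<sigma>: "\<And>x. \<sigma> x \<in> C" "\<And>x s. s \<in> C \<Longrightarrow> s \<bullet> (x - a) \<le> \<sigma> x \<bullet> (x - a)"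
    by metis
  define h where "h x = max 1 (\<sigma> x \<bullet> (x - a))" for x
  have h_ge: "s \<bullet> (x - a) \<le> h x" if "s \<in> C" for s x
    using \<sigma>(2)[OF that, of x] by (simp add: h_def)
  have h_ge1: "1 \<le> h x" for x
    by (simp add: h_def)
  have sub: "\<exists>s. norm s \<le> 1 / r \<and> (\<forall>y. h x + s \<bullet> (y - x) \<le> h y) \<and>
           (if x \<in> K then h x = 1 \<and> s = 0 else s \<bullet> (x - a) = h x)" for x
  proof (cases "x \<in> K")
    case True
    then have "\<sigma> x \<bullet> (x - a) \<le> 1"
      using \<sigma>(1)[of x] by (auto simp: C_def)
    then have "h x = 1"
      by (simp add: h_def)
    \<comment> \<open>On \<open>K\<close> the function \<open>h\<close> takes its global minimum 1,
      so 0 is a subgradient.\<close>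
    then show ?thesis
      using True r h_ge1 by (intro exI[of _ 0]) auto
  next
    case False
    then obtain c b where cb: "c \<bullet> x < b" "\<And>y. y \<in> K \<Longrightarrow> b < c \<bullet> y"
      using separating_hyperplane_closed_point[OF assms(1) compact_imp_closed[OF assms(2)]] by metis
    \<comment> \<open>Dividing the separating functional by its gap \<open>\<gamma>\<close> at
      \<open>a\<close> gives a polar vector whose value at \<open>x\<close> exceeds 1. Hence the
      maximum in \<open>h x\<close> is attained by the gauge.\<close>
    define \<gamma> where "\<gamma> = c \<bullet> a - b"
    have \<gamma>: "0 < \<gamma>"
      using cb(2)[OF aK] by (simp add: \<gamma>_def)
    let ?s = "- (c /\<^sub>R \<gamma>)"
    have s: "?s \<bullet> (y - a) = (c \<bullet> a - c \<bullet> y) / \<gamma>" for y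
      by (simp add: inner_diff_right divide_inverse algebra_simps)
    have "?s \<bullet> (y - a) \<le> 1" if "y \<in> K" for y
      unfolding s using cb(2)[OF that] \<gamma> by (simp add: \<gamma>_def)
    then have "?s \<in> C"
      by (simp add: C_def)
    moreover have "1 < ?s \<bullet> (x - a)"
      unfolding s using cb(1) \<gamma> by (simp add: \<gamma>_def)
    ultimately have hx: "h x = \<sigma> x \<bullet> (x - a)"
      using \<sigma>(2)[of ?s x] by (simp add: h_def)
    \<comment> \<open>The maximiser at \<open>x\<close> competes in the supremum at every other
      point \<open>y\<close>.\<close>
    have "h x + \<sigma> x \<bullet> (y - x) \<le> h y" for y
      using h_ge[OF \<sigma>(1)[of x], of y] hx by (simp add: inner_diff_right)
    then show ?thesis
      using False hx C_bound[OF \<sigma>(1)] by auto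
  qed
  obtain R where R: "0 < R" "\<And>y. y \<in> K \<Longrightarrow> norm (y - a) \<le> R"
    using bounded_subset_ballD[OF compact_imp_bounded[OF assms(2)], of a]
    by (force simp: dist_norm norm_minus_commute subset_iff)
  have "norm (x - a) \<le> R * h x" for x
  proof (cases "x = a")
    case False
    \<comment> \<open>As \<open>K\<close> lies within distance \<open>R\<close> of \<open>a\<close>,
      the radial unit vector divided by \<open>R\<close> is polar; testing it at \<open>x\<close>
      gives the bound.\<close>
    let ?s = "(x - a) /\<^sub>R (R * norm (x - a))"
    have s: "?s \<bullet> z = (x - a) \<bullet> z / (R * norm (x - a))" for z
      by (simp only: inner_scaleR_left divide_inverse mult.commute)
    have "?s \<bullet> (y - a) \<le> 1" if "y \<in> K" for y
    proof -
      have "(x - a) \<bullet> (y - a) \<le> norm (x - a) * norm (y - a)"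
        by (rule norm_cauchy_schwarz)
      also have "\<dots> \<le> norm (x - a) * R"
        by (intro mult_left_mono R that) auto
      finally show ?thesis
        using R(1) False unfolding s by (simp add: mult.commute)
    qed
    then have "?s \<in> C"
      by (simp add: C_def)
    from h_ge[OF this, of x] show ?thesis
      using R(1) False unfolding s by (simp add: dot_square_norm power2_eq_square field_simps)
  qed (use R(1) h_ge1[of a] in simp)
  then show ?thesis
    using that[of h R "1 / r"] h_ge1 R(1) sub by blast
qed

subsection \<open>The radial retraction\<close>

text \<open>A discrete quotient rule, arranged so that every factor has a known limit:
  \<open>h\<close> at the shifted point by continuity and its quotient by convexity.\<close>

lemma dir_quot_component_divide:
  fixes h :: "real^'n::finite \<Rightarrow> real"
  assumes "\<And>x. h x \<noteq> 0"
  shows "dir_quot (\<lambda>x. (x - a) $ i / h x) v n x =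
    v $ i / h (x + v /\<^sub>R real (Suc n)) - (x - a) $ i * dir_quot h v n x / (h x * h (x + v /\<^sub>R real (Suc n)))"
proof -
  define m where "m = real (Suc n)"
  have m: "m \<noteq> 0"
    by (simp add: m_def)
  have "m * ((x + v /\<^sub>R m - a) $ i / h' - (x - a) $ i / h x) =
      v $ i / h' - (x - a) $ i * (m * (h' - h x)) / (h x * h')" if "h' \<noteq> 0" for h'
    using assms[of x] m that by (simp add: field_simps)
  then show ?thesis
    using assms unfolding dir_quot_def m_def by blast
qed

lemma det_eq_0_kernel:
  fixes A :: "real^'n::finite^'n"
  assumes "A *v x = 0" "x \<noteq> 0"
  shows "det A = 0"
  using assms invertible_det_nz[of A] matrix_left_invertible_ker[of A] by (auto simp: invertible_def)

text \<open>On \<open>K\<close> the map below is the identity, up to translation; outside \<open>K\<close> it is positively homogeneous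
  of degree 0 about \<open>a\<close>, so that \<open>x - a\<close> is in the kernel of its gradient.\<close>

lemma radial_retraction:
  fixes K :: "(real^'n::finite) set" and p :: real
  assumes K: "convex K" "compact K" and a: "a \<in> interior K" and p: "1 < p"
  shows "\<exists>(u :: real^'n \<Rightarrow> real^'n) G. (\<exists>B. \<forall>x. norm (u x) \<le> B) \<and> u \<in> borel_measurable borel \<and>
    has_weak_jacobian u G \<and> G \<in> Lq (real CARD('n) * p) \<and>
    (AE x in lebesgue. det (G x) = indicat_real K x)"
proof -
  obtain h M R where h_ge1: "\<And>x. 1 \<le> h x" and h_ge: "\<And>x. norm (x - a) \<le> R * h x" and R: "0 < R"
    and sub: "\<And>x. \<exists>s. norm s \<le> M \<and> (\<forall>y. h x + s \<bullet> (y - x) \<le> h y) \<and>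
           (if x \<in> K then h x = 1 \<and> s = 0 else s \<bullet> (x - a) = h x)"
    using convex_body_gauge[OF K a] by metis
  have cvx: "convex_on UNIV h" and lip: "M-lipschitz_on UNIV h"
    using convex_lipschitz_of_subgradients[of M h] sub by meson+
  have M: "0 \<le> M"
    using lip by (rule lipschitz_on_nonneg)
  have h_pos: "0 < h x" "h x \<noteq> 0" for x
    using h_ge1[of x] by auto
  have cont: "continuous_on UNIV h"
    by (rule lipschitz_on_continuous_on[OF lip])
  then have [measurable]: "h \<in> borel_measurable borel"
    by (rule borel_measurable_continuous_onI)
  \<comment> \<open>The left partial derivative of \<open>h\<close>, to match the backward quotients
    in \<open>has_weak_partial_lipschitz\<close>.\<close>
  define D where "D j x = - dir_lim h (- axis j 1) x" for j x
  have D_le: "\<bar>D j x\<bar> \<le> M" for j x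
    using abs_dir_lim_le[OF cvx lip, of "- axis j 1" x] by (simp add: D_def)
  have [measurable]: "D j \<in> borel_measurable borel" for j
    unfolding D_def using measurable_dir_lim[OF cvx lip] by measurable
  define f where "f i x = (x - a) $ i / h x" for i x
  define u where "u x = (x - a) /\<^sub>R h x" for x
  define g where "g i j x = (if i = j then 1 else 0) / h x - (x - a) $ i * D j x / (h x)\<^sup>2" for i j x
  define G :: "real^'n \<Rightarrow> real^'n^'n" where "G x = (\<chi> i j. g i j x)" for x
  have uf: "u x $ i = f i x" for x i
    by (simp add: u_def f_def divide_inverse)
  have comp_le: "\<bar>(x - a) $ i\<bar> \<le> R * h x" for x i
    using component_le_norm_cart[of "x - a" i] h_ge[of x] by linarith
  have f_le: "\<bar>f i x\<bar> \<le> R" for i x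
    using comp_le[of x i] h_pos[of x] by (simp add: f_def field_simps)
  have f_lip: "(1 + R * M)-lipschitz_on UNIV (f i)" for i
  proof (rule lipschitz_onI)
    fix x y :: "real^'n"
    \<comment> \<open>The split leaves \<open>f i y\<close>, bounded by \<open>R\<close>, as the
      coefficient of the increment of \<open>h\<close>; the remaining denominators are at least
      1.\<close>
    have eq: "f i x - f i y = (x - y) $ i / h x + f i y * ((h y - h x) / h x)"
      using h_pos[of x] h_pos[of y] by (simp add: f_def field_simps)
    have "\<bar>(x - y) $ i / h x\<bar> \<le> norm (x - y) / 1"
      unfolding abs_divide using h_ge1[of x] component_le_norm_cart[of "x - y" i]
      by (intro frac_le) auto
    moreover have "\<bar>f i y * ((h y - h x) / h x)\<bar> \<le> R * (M * norm (x - y) / 1)"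
      unfolding abs_mult abs_divide using h_ge1[of x] lipschitz_onD[OF lip, of y x] R
      by (intro mult_mono frac_le f_le) (auto simp: dist_norm norm_minus_commute)
    ultimately have "\<bar>f i x - f i y\<bar> \<le> norm (x - y) / 1 + R * (M * norm (x - y) / 1)"
      unfolding eq by (intro order_trans[OF abs_triangle_ineq add_mono])
    then show "dist (f i x) (f i y) \<le> (1 + R * M) * dist x y"
      by (simp add: dist_norm algebra_simps)
  qed (use R M in auto)
  have quot: "(\<lambda>n. dir_quot (f i) (- axis j 1) n x) \<longlonglongrightarrow> - g i j x" for i j x
  proof -
    have "(\<lambda>n. x + inverse (real (Suc n)) *\<^sub>R (- axis j 1)) \<longlonglongrightarrow> x + 0 *\<^sub>R (- axis j 1)"
      by (intro tendsto_intros LIMSEQ_inverse_real_of_nat)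
    then have hl: "(\<lambda>n. h (x + (- axis j 1) /\<^sub>R real (Suc n))) \<longlonglongrightarrow> h x"
      by (intro continuous_on_tendsto_compose[OF cont]) auto
    have "(\<lambda>n. dir_quot (f i) (- axis j 1) n x) \<longlonglongrightarrow>
        (- axis j 1) $ i / h x - (x - a) $ i * dir_lim h (- axis j 1) x / (h x * h x)"
      unfolding f_def dir_quot_component_divide[OF h_pos(2)]
      by (intro tendsto_intros hl tendsto_dir_lim[OF cvx lip]) (use h_pos in auto)
    also have "(- axis j 1) $ i / h x - (x - a) $ i * dir_lim h (- axis j 1) x / (h x * h x) = - g i j x"
      by (auto simp: g_def D_def axis_def power2_eq_square)
    finally show ?thesis .
  qed
  have jac: "has_weak_jacobian u G"
    unfolding has_weak_jacobian_def uf G_def by (auto intro: has_weak_partial_lipschitz[OF f_le f_lip quot])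
  have G_meas: "G \<in> borel_measurable borel"
  proof -
    have [measurable]: "(\<lambda>x. (x - a) $ i) \<in> borel_measurable borel" for i
      by (intro borel_measurable_continuous_onI continuous_intros)
    have "g i j \<in> borel_measurable borel" for i j
      unfolding g_def by measurable
    then show ?thesis
      by (auto simp: borel_measurable_euclidean_space[of G] Basis_vec_def G_def inner_axis)
  qed
  \<comment> \<open>In the second term of \<open>g\<close>, the bound |x - a| \<le> R h(x) absorbs
    one power of \<open>h\<close>. The two factors \<open>CARD('n)\<close> come from estimating
    Euclidean norms by sums.\<close>
  have G_le: "norm (G x) \<le> real CARD('n) * (real CARD('n) * (1 + R * M)) / h x" for x
  proof -
    have g_le: "\<bar>g i j x\<bar> \<le> (1 + R * M) / h x" for i j
    proof -
      have "\<bar>(x - a) $ i * D j x / (h x)\<^sup>2\<bar> \<le> R * h x * M / (h x)\<^sup>2"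
        unfolding abs_divide abs_mult using h_pos[of x] R
        by (intro divide_mono mult_mono comp_le D_le) auto
      also have "\<dots> = R * M / h x"
        using h_pos[of x] by (simp add: power2_eq_square)
      finally have "\<bar>(x - a) $ i * D j x / (h x)\<^sup>2\<bar> \<le> R * M / h x" .
      moreover have "\<bar>(if i = j then 1 else 0) / h x\<bar> \<le> 1 / h x"
        using h_pos[of x] by auto
      ultimately show ?thesis
        unfolding g_def add_divide_distrib by linarith
    qed
    have "norm (G x $ i) \<le> real CARD('n) * ((1 + R * M) / h x)" for i
    proof -
      have "norm (G x $ i) \<le> (\<Sum>j\<in>UNIV. \<bar>G x $ i $ j\<bar>)"
        by (rule norm_le_l1_cart)
      also have "\<dots> \<le> real CARD('n) * ((1 + R * M) / h x)"
        by (rule sum_bounded_above) (simp add: G_def g_le)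
      finally show ?thesis .
    qed
    moreover have "norm (G x) \<le> (\<Sum>i\<in>UNIV. norm (G x $ i))"
      unfolding norm_vec_def[of "G x"] by (rule L2_set_le_sum) auto
    ultimately have "norm (G x) \<le> real CARD('n) * (real CARD('n) * ((1 + R * M) / h x))"
      using sum_bounded_above[of UNIV "\<lambda>i. norm (G x $ i)"] order_trans by blast
    then show ?thesis
      by simp
  qed
  let ?q = "real CARD('n) * p"
  have G_Lq: "G \<in> Lq ?q"
  proof -
    \<comment> \<open>The last factor comes from 1 + |x| \<le> (1 + |a| + R) h(x), which turns decay
      in 1 / h into decay in 1 / (1 + |x|).\<close>
    define c where "c = real CARD('n) * (real CARD('n) * (1 + R * M)) * (1 + norm a + R)"
    have c: "0 \<le> c"
      using R M by (simp add: c_def)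
    have "norm (G x) \<le> c / (1 + norm x)" for x
    proof -
      have "norm x \<le> norm a + R * h x"
        using h_ge[of x] norm_triangle_sub[of x a] by linarith
      moreover have "norm a \<le> norm a * h x"
        using h_ge1[of x] by (simp add: mult_le_cancel_left1)
      ultimately have "1 + norm x \<le> (1 + norm a + R) * h x"
        using h_ge1[of x] by (simp add: algebra_simps)
      then have le: "1 / h x \<le> (1 + norm a + R) / (1 + norm x)"
        using h_pos[of x] norm_ge_zero[of x] by (simp add: field_simps del: norm_ge_zero)
      have "norm (G x) \<le> real CARD('n) * (real CARD('n) * (1 + R * M)) * (1 / h x)"
        using G_le[of x] by simp
      also have "\<dots> \<le> real CARD('n) * (real CARD('n) * (1 + R * M)) * ((1 + norm a + R) / (1 + norm x))"
        using R M by (intro mult_left_mono le) auto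
      finally show ?thesis
        by (simp add: c_def)
    qed
    then have "norm (G x) powr ?q \<le> (c / (1 + norm x)) powr ?q" for x
      using p by (intro powr_mono2) auto
    then have le: "norm (G x) powr ?q \<le> c powr ?q * (1 + norm x) powr (- ?q)" for x
      using c by (simp add: powr_divide powr_minus_divide)
    have iw: "integrable lborel (\<lambda>x::real^'n. c powr ?q * (1 + norm x) powr (- ?q))"
      using integrable_inverse_powr[OF p, where 'a = "real^'n"] by (intro integrable_mult_right) simp
    have [measurable]: "(\<lambda>x. norm (G x) powr ?q) \<in> borel_measurable borel"
      using G_meas by measurable
    have "integrable lborel (\<lambda>x. norm (G x) powr ?q)"
      by (rule Bochner_Integration.integrable_bound[OF iw]) (use le in auto)
    then show ?thesis
      using G_meas by (simp add: Lq_def integrable_completion measurable_completion)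
  qed
  have "AE x in lborel. \<forall>j\<in>UNIV. dir_lim h (- axis j 1) x = - dir_lim h (axis j 1) x"
    by (intro AE_finite_allI AE_convex_dir_lim_minus[OF cvx lip]) auto
  then have "AE x in lborel. det (G x) = indicat_real K x"
  proof eventually_elim
    case (elim x)
    obtain s where s: "\<And>y. h x + s \<bullet> (y - x) \<le> h y"
      and sK: "if x \<in> K then h x = 1 \<and> s = 0 else s \<bullet> (x - a) = h x"
      using sub by blast
    \<comment> \<open>Where the one-sided derivatives agree, the subgradient bounds in directions
      e_j and -e_j squeeze the derivative to the component of \<open>s\<close>.\<close>
    have D: "D j x = s $ j" for j
    proof -
      have "s $ j \<le> dir_lim h (axis j 1) x" "- s $ j \<le> dir_lim h (- axis j 1) x"
        using subgradient_le_dir_lim[OF cvx lip s, of "axis j 1"]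
          subgradient_le_dir_lim[OF cvx lip s, of "- axis j 1"] by (simp_all add: inner_axis)
      then show ?thesis
        using elim by (simp add: D_def)
    qed
    show ?case
    proof (cases "x \<in> K")
      case True
      then have "G x = mat 1"
        using sK by (simp add: G_def g_def D mat_def vec_eq_iff)
      then show ?thesis
        using True by simp
    next
      case False
      then have sx: "s \<bullet> (x - a) = h x"
        using sK by simp
      \<comment> \<open>Euler's identity \<open>sx\<close> makes the two terms of the quotient rule
        cancel on the radial vector.\<close>
      have "(G x *v (x - a)) $ i = 0" for i
      proof -
        have "(G x *v (x - a)) $ i =
            (\<Sum>j\<in>UNIV. (if i = j then (x - a) $ j / h x else 0) - (x - a) $ i / (h x)\<^sup>2 * (s $ j * (x - a) $ j))"
          unfolding matrix_vector_mult_def G_def g_def D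
          by (auto intro!: sum.cong simp: field_simps)
        also have "\<dots> = (x - a) $ i / h x - (x - a) $ i / (h x)\<^sup>2 * (s \<bullet> (x - a))"
          by (simp add: sum_subtractf inner_vec_def sum_distrib_left sum_divide_distrib)
        also have "\<dots> = 0"
          unfolding sx using h_pos[of x] by (simp add: power2_eq_square)
        finally show ?thesis .
      qed
      then have "G x *v (x - a) = 0"
        by (simp add: vec_eq_iff)
      moreover have "x - a \<noteq> 0"
        using sx h_pos[of x] by auto
      ultimately show ?thesis
        using False by (simp add: det_eq_0_kernel)
    qed
  qed
  then have "AE x in lebesgue. det (G x) = indicat_real K x"
    by (rule AE_completion)
  moreover have "norm (u x) \<le> R" for x
    using h_ge[of x] h_pos[of x] by (simp add: u_def pos_divide_le_eq divide_inverse_commute[symmetric])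
  moreover have "u \<in> borel_measurable borel"
    unfolding u_def by measurable
  ultimately show ?thesis
    using jac G_Lq by blast
qed

section \<open>Arbitrary convex compact sets\<close>

lemma has_weak_jacobian_0: "has_weak_jacobian (\<lambda>x. 0) (\<lambda>x. 0)"
  by (auto simp: has_weak_jacobian_def has_weak_partial_def intro!: locally_integrable_bounded[of _ 0])

theorem proposition3p2:
  fixes K :: "(real^'n::finite) set" and p :: real
  assumes "CARD('n) \<ge> 2"
    and "convex K" and "compact K"
    and "1 < p"
  shows "\<exists>u :: real^'n \<Rightarrow> real^'n.
           u \<in> homogeneous_sobolev (real CARD('n) * p) \<inter> Linf \<and>
           (\<exists>G. has_weak_jacobian u G \<and>
                (AE x in lebesgue. det (G x) = indicat_real K x))"
proof -
  have "\<exists>(u :: real^'n \<Rightarrow> real^'n) G. (\<exists>B. \<forall>x. norm (u x) \<le> B) \<and> u \<in> borel_measurable borel \<and>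
    has_weak_jacobian u G \<and> G \<in> Lq (real CARD('n) * p) \<and>
    (AE x in lebesgue. det (G x) = indicat_real K x)"
  proof (cases "interior K = {}")
    case True
    then have "K \<in> null_sets lebesgue"
      using negligible_convex_interior[OF assms(2)] negligible_iff_null_sets by blast
    moreover have "det (0 :: real^'n^'n) = 0"
      using det_0 by (simp add: mat_def zero_vec_def)
    ultimately have "AE x in lebesgue. det (0 :: real^'n^'n) = indicat_real K x"
      \<comment> \<open>The exceptional set is \<open>K\<close> itself, since off \<open>K\<close>
        both sides are 0.\<close>
      by (intro AE_I'[of K]) (auto simp: indicator_def)
    then show ?thesis
      using has_weak_jacobian_0 by (intro exI[of _ "\<lambda>x. 0"]) (auto simp: Lq_def)
  next
    case False
    then show ?thesis
      using radial_retraction[OF assms(2,3) _ assms(4)] by blast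
  qed
  then obtain u :: "real^'n \<Rightarrow> real^'n" and G B where u: "\<And>x. norm (u x) \<le> B" "u \<in> borel_measurable borel"
    and G: "has_weak_jacobian u G" "G \<in> Lq (real CARD('n) * p)"
      "AE x in lebesgue. det (G x) = indicat_real K x"
    by blast
  have "locally_integrable u"
    using locally_integrable_bounded[OF u(2,1)] .
  moreover have "u \<in> Linf"
    unfolding Linf_def using u by (auto intro!: measurable_completion)
  ultimately show ?thesis
    using G unfolding homogeneous_sobolev_def by blast
qed

end
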